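(* Suppose there exists $\mathcal B'\subseteq\mathcal B$ such that 1. for all $b,b'\in\mathcal B'$: (i) $\phi(b,t)-\phi(b',t)$ is single-crossing in $t$; (ii) $v(b,t)-v(b',t)$ is monotonic in $t$; and 2. for every $t\in T$, $\operatorname{argmax}_{b\in\mathcal B}\phi(b,t)\subseteq\mathcal B'$. Then the set of minimal optimal menus of the monopolist's problem is equal to the set of minimal optimal menus of the upper-envelope problem. In particular, every minimal optimal menu is a subset of $\mathcal B'$.
   Context: Setup. There are $n\ge 1$ goods; $\mathcal B=2^{\{1,\dots,n\}}$ is the set of (deterministic) bundles and $\Delta(\mathcal B)$ is the set of probability distributions on $\mathcal B$ (stochastic bundles); a bundle $b$ is identified with the point mass at $b$. Types $t$ lie in $T=[\underline t,\bar t]\subseteq\mathbb R$, $\underline t<\bar t$, and are distributed according to $F$ with a continuous, positive density $f$. The value function $v:\Delta(\mathcal B)\times T\to\mathbb R$ is continuously differentiable in $t$, with $v(\emptyset,t)=0$ for all $t$ and $v(a,t)=\mathbb E_{b\sim a}[v(b,t)]$. The virtual value function is $\phi(b,t)=v(b,t)-\frac{1-F(t)}{f(t)}v_t(b,t)$, $v_t=\partial v/\partial t$, extended by $\phi(a,t)=\mathbb E_{b\sim a}[\phi(b,t)]$ for $a\in\Delta(\mathcal B)$. Standing assumptions: for $b\ne b'$ in $\mathcal B$ there is $t\in T$ with $\phi(b,t)\neq\phi(b',t)$; and $\max_{b\neq\emptyset}\phi(b,\underline t)<0=\phi(\emptyset,\underline t)$. Terminology. A function $g:T\to\mathbb R$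 is single-crossing in $t$ if $\operatorname{sign}[g(t)]\in\{-1,0,1\}$ is a monotonic function of $t$ (either weakly increasing or weakly decreasing). "Monotonic" means weakly increasing or weakly decreasing on $T$. Monopolist's problem. A mechanism is a measurable map $(a,p):T\to\Delta(\mathcal B)\times\mathbb R$. It is IC if $v(a(t),t)-p(t)\ge v(a(t'),t)-p(t')$ for all $t,t'\in T$, and IR if $v(a(t),t)-p(t)\ge 0$ for all $t\in T$. The monopolist maximizes $\mathbb E[p(t)]$ over IC and IR mechanisms; by the envelope theorem this objective can be written as $\mathbb E[\sum_{b\in\mathcal B}a_b(t)\phi(b,t)]-[v(a(\underline t),\underline t)-p(\underline t)]$, where $a_b(t)$ is the weight that $a(t)$ puts on $b$. A menu $B\subseteq\mathcal B$ is optimal for the monopolist's problem if there is an optimal mechanism $(a,p)$ with $a(t)\in B$ for all $t$; an optimal menu $B$ is a minimal optimal menu if no $B'\subsetneq B$ is optimal. Upper-envelope problem. This is the unconstrained problem with value $\mathbb E[\max_{b\in\mathcal B}\phi(b,t)]$. A menu $B\subseteq\mathcal B$ is optimal for it if for every $t\in T$ some element of $\operatorname{argmax}_{b\in\mathcal B}\phi(b,t)$ belongs to $B$; it is a minimal optimal menu if moreover no $B'\subsetneq B$ is optimal for it. *)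

theory Defs
  imports "HOL-Probability.Probability"
begin

definition monotonic_on :: "real set \<Rightarrow> (real \<Rightarrow> real) \<Rightarrow> bool" where
  "monotonic_on S g \<longleftrightarrow> monotone_on S (\<le>) (\<le>) g \<or> monotone_on S (\<le>) (\<ge>) g"

definition single_crossing_on :: "real set \<Rightarrow> (real \<Rightarrow> real) \<Rightarrow> bool" where
  "single_crossing_on S g \<longleftrightarrow> monotonic_on S (\<lambda>t. sgn (g t))"

text \<open>
  Goods are \<open>1, \<dots>, n\<close>, types lie in \<open>[tl, th]\<close>, \<open>f\<close> is the density of the type
  distribution, and \<open>v\<close> gives the value of deterministic bundles. Functions of the type are total
  on the reals, but only their values on \<open>[tl, th]\<close> are ever used.
\<close>

locale monopoly_data =
  fixes n :: nat
    and tl th :: real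
    and f :: "real \<Rightarrow> real"
    and v :: "nat set \<Rightarrow> real \<Rightarrow> real"
begin

definition bundles :: "nat set set" where
  "bundles = Pow {1..n}"

definition T :: "real set" where
  "T = {tl..th}"

definition type_dist :: "real measure" where
  "type_dist = density (restrict_space lborel T) (\<lambda>t. ennreal (f t))"

definition F :: "real \<Rightarrow> real" where
  "F t = measure type_dist {s \<in> T. s \<le> t}"

text \<open>The derivative is taken within \<open>T\<close>, hence one-sided at the endpoints.\<close>

definition v_t :: "nat set \<Rightarrow> real \<Rightarrow> real" where
  "v_t b t = vector_derivative (v b) (at t within T)"

definition \<phi> :: "nat set \<Rightarrow> real \<Rightarrow> real" where
  "\<phi> b t = v b t - (1 - F t) / f t * v_t b t"

definition stochastic_bundles :: "nat set pmf set" where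
  "stochastic_bundles = {a. set_pmf a \<subseteq> bundles}"

definition value_of :: "nat set pmf \<Rightarrow> real \<Rightarrow> real" where
  "value_of a t = measure_pmf.expectation a (\<lambda>b. v b t)"

text \<open>
  A map into the simplex of stochastic bundles is Borel measurable iff all of its weights are.
\<close>

definition mechanism :: "(real \<Rightarrow> nat set pmf) \<Rightarrow> (real \<Rightarrow> real) \<Rightarrow> bool" where
  "mechanism a p \<longleftrightarrow>
     (\<forall>t\<in>T. a t \<in> stochastic_bundles) \<and>
     (\<forall>b\<in>bundles. (\<lambda>t. pmf (a t) b) \<in> borel_measurable (restrict_space borel T)) \<and>
     p \<in> borel_measurable (restrict_space borel T)"

definition IC :: "(real \<Rightarrow> nat set pmf) \<Rightarrow> (real \<Rightarrow> real) \<Rightarrow> bool" where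
  "IC a p \<longleftrightarrow> (\<forall>t\<in>T. \<forall>t'\<in>T. value_of (a t) t - p t \<ge> value_of (a t') t - p t')"

definition IR :: "(real \<Rightarrow> nat set pmf) \<Rightarrow> (real \<Rightarrow> real) \<Rightarrow> bool" where
  "IR a p \<longleftrightarrow> (\<forall>t\<in>T. value_of (a t) t - p t \<ge> 0)"

text \<open>
  Incentive compatibility bounds the payments of a mechanism on \<open>T\<close>, so the integral below never
  takes its default value for non-integrable functions.
\<close>

definition revenue :: "(real \<Rightarrow> real) \<Rightarrow> real" where
  "revenue p = integral\<^sup>L type_dist p"

definition optimal_mechanism :: "(real \<Rightarrow> nat set pmf) \<Rightarrow> (real \<Rightarrow> real) \<Rightarrow> bool" where
  "optimal_mechanism a p \<longleftrightarrow>
     mechanism a p \<and> IC a p \<and> IR a p \<and>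
     (\<forall>a' p'. mechanism a' p' \<and> IC a' p' \<and> IR a' p' \<longrightarrow> revenue p' \<le> revenue p)"

definition optimal_menu :: "nat set set \<Rightarrow> bool" where
  "optimal_menu B \<longleftrightarrow>
     B \<subseteq> bundles \<and> (\<exists>a p. optimal_mechanism a p \<and> (\<forall>t\<in>T. a t \<in> return_pmf ` B))"

definition minimal_optimal_menu :: "nat set set \<Rightarrow> bool" where
  "minimal_optimal_menu B \<longleftrightarrow> optimal_menu B \<and> (\<forall>B'. B' \<subset> B \<longrightarrow> \<not> optimal_menu B')"

definition argmax_\<phi> :: "real \<Rightarrow> nat set set" where
  "argmax_\<phi> t = {b. is_arg_max (\<lambda>b. \<phi> b t) (\<lambda>b. b \<in> bundles) b}"

definition envelope_optimal_menu :: "nat set set \<Rightarrow> bool" where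
  "envelope_optimal_menu B \<longleftrightarrow> B \<subseteq> bundles \<and> (\<forall>t\<in>T. argmax_\<phi> t \<inter> B \<noteq> {})"

definition minimal_envelope_optimal_menu :: "nat set set \<Rightarrow> bool" where
  "minimal_envelope_optimal_menu B \<longleftrightarrow>
     envelope_optimal_menu B \<and> (\<forall>B'. B' \<subset> B \<longrightarrow> \<not> envelope_optimal_menu B')"

end

locale monopoly = monopoly_data +
  assumes n_ge_1: "n \<ge> 1"
    and tl_less_th: "tl < th"
    and f_continuous: "continuous_on T f"
    and f_positive: "\<And>t. t \<in> T \<Longrightarrow> f t > 0"
    and prob_type_dist: "prob_space type_dist"
    and v_differentiable: "\<And>b. b \<in> bundles \<Longrightarrow> v b differentiable_on T"
    and v_t_continuous: "\<And>b. b \<in> bundles \<Longrightarrow> continuous_on T (v_t b)"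
    and v_empty: "\<And>t. t \<in> T \<Longrightarrow> v {} t = 0"
    and \<phi>_distinct:
      "\<And>b b'. b \<in> bundles \<Longrightarrow> b' \<in> bundles \<Longrightarrow> b \<noteq> b' \<Longrightarrow> \<exists>t\<in>T. \<phi> b t \<noteq> \<phi> b' t"
    and \<phi>_lowest: "Max ((\<lambda>b. \<phi> b tl) ` (bundles - {{}})) < 0" "\<phi> {} tl = 0"

end

theory Submission
  imports Defs
begin

text \<open>
  Both problems have the same optimal menus. By the envelope theorem every IC and IR mechanism that
  uses only bundles of a menu \<open>B\<close> earns at most the expectation of \<open>max\<^bsub>b \<in> B\<^esub> \<phi> b t\<close>. Conversely, let
  \<open>B\<close> meet every argmax, and let type \<open>t\<close> get the bundle in \<open>B\<close> and the argmax at \<open>t\<close> whose value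
  increases most from \<open>tl\<close> to \<open>th\<close>. If \<open>v b - v c\<close> is decreasing, then \<open>\<phi> b - \<phi> c\<close> is smallest at
  \<open>th\<close>, so it cannot cross zero from below; hence along this selection the differences of values
  are increasing, the selection is implementable with zero rent for \<open>tl\<close>, and it earns the full
  expectation of \<open>max\<^bsub>b\<^esub> \<phi> b t\<close>. So an optimal menu \<open>B\<close> attains this expectation, and as both maxima
  are continuous and the density is positive, \<open>B\<close> meets the argmax at every \<open>t\<close>.
\<close>

section \<open>Difference quotients and the integral form of the envelope theorem\<close>

text \<open>Since \<open>U\<close> is only Lipschitz, its difference quotients are averaged instead of differentiated.\<close>

lemma integral_le_increment:
  fixes U q :: "real \<Rightarrow> real"
  assumes xy: "x \<le> y"
    and lip: "\<And>s t. s \<in> {x..y} \<Longrightarrow> t \<in> {x..y} \<Longrightarrow> \<bar>U s - U t\<bar> \<le> L * \<bar>s - t\<bar>"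
    and q: "q integrable_on {x..y}"
    and bound: "\<And>t. t \<in> {x..y} \<Longrightarrow> \<bar>q t\<bar> \<le> L"
    and unif: "\<And>\<epsilon>. \<epsilon> > 0 \<Longrightarrow> \<exists>\<delta>>0. \<forall>t\<in>{x..y}. \<forall>s\<in>{x..y}.
       t \<le> s \<and> s - t < \<delta> \<longrightarrow> (s - t) * (q t - \<epsilon>) \<le> U s - U t"
  shows "integral {x..y} q \<le> U y - U x"
proof (cases "x = y")
  case False
  with xy have "x < y" by simp
  have L0: "L \<ge> 0" using bound[of x] xy by auto
  have cont: "continuous_on {x..y} U"
  proof (rule lipschitz_on_continuous_on[of L], rule lipschitz_onI)
    show "dist (U s) (U t) \<le> L * dist s t" if "s \<in> {x..y}" "t \<in> {x..y}" for s t
      using lip[OF that] by (simp add: dist_real_def)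
  qed (fact L0)
  have U_int: "U integrable_on {a..b}" if "x \<le> a" "b \<le> y" for a b
    by (rule integrable_continuous_real) (rule continuous_on_subset[OF cont], use that in auto)
  \<comment> \<open>In the error term, \<open>2 * L\<close> comes from the end strips of
    \<open>U\<close>, another \<open>L\<close> from the last strip of \<open>q\<close>, and
    \<open>y - x\<close> from lowering \<open>q\<close> by \<open>\<epsilon>\<close>.\<close>
  have key: "integral {x..y} q \<le> U y - U x + \<epsilon> * ((y - x) + 3 * L)" if eps: "\<epsilon> > 0" for \<epsilon>
  proof -
    obtain \<delta> where \<delta>: "\<delta> > 0" "\<And>t s. t \<in> {x..y} \<Longrightarrow> s \<in> {x..y} \<Longrightarrow> t \<le> s \<Longrightarrow> s - t < \<delta> \<Longrightarrow>
       (s - t) * (q t - \<epsilon>) \<le> U s - U t" using unif[OF eps] by blast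
    \<comment> \<open>\<open>h < \<delta>\<close> makes the uniform bound available for steps of
      length \<open>h\<close>, \<open>h \<le> \<epsilon>\<close> absorbs the boundary terms of size
      \<open>L * h\<close>, and \<open>h < y - x\<close> keeps the shortened interval
      nondegenerate.\<close>
    define h where "h = min \<epsilon> (min (\<delta>/2) ((y - x)/2))"
    have h: "h > 0" "h < \<delta>" "h < y - x" "h \<le> \<epsilon>" "h \<le> (y - x) / 2"
      using \<open>\<delta> > 0\<close> \<open>\<epsilon> > 0\<close> \<open>x < y\<close> by (auto simp: h_def min_def)
    have shift_int: "(\<lambda>t. U (t + h)) integrable_on {x..y - h}"
      by (intro integrable_continuous_real continuous_on_compose2[OF cont] continuous_intros) (use h in auto)
    have shift: "integral {x..y - h} (\<lambda>t. U (t + h)) = integral {x + h..y} U"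
      using integral_shift_real_ivl[of "x + h" h y U] by simp
    have qh: "q integrable_on {x..y - h}" "q integrable_on {y - h..y}"
      by (rule integrable_on_subinterval[OF q], use h in auto)+
    have "h * (integral {x..y - h} q - \<epsilon> * (y - h - x)) = integral {x..y - h} (\<lambda>t. h * (q t - \<epsilon>))"
    proof (rule integral_unique[symmetric], rule has_integral_mult_right, rule has_integral_diff)
      show "(q has_integral integral {x..y - h} q) {x..y - h}" using qh by (simp add: integrable_integral)
      show "((\<lambda>t. \<epsilon>) has_integral \<epsilon> * (y - h - x)) {x..y - h}"
        using has_integral_const_real[of \<epsilon> x "y - h"] h by (simp add: mult.commute)
    qed
    also have "\<dots> \<le> integral {x..y - h} (\<lambda>t. U (t + h) - U t)"
    proof (rule integral_le)
      show "(\<lambda>t. h * (q t - \<epsilon>)) integrable_on {x..y - h}"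
        using qh by (intro integrable_on_mult_right Henstock_Kurzweil_Integration.integrable_diff) auto
      show "(\<lambda>t. U (t + h) - U t) integrable_on {x..y - h}"
        using shift_int U_int[of x "y - h"] h by (intro Henstock_Kurzweil_Integration.integrable_diff) auto
      show "h * (q t - \<epsilon>) \<le> U (t + h) - U t" if "t \<in> {x..y - h}" for t
        using \<delta>(2)[of t "t + h"] that h by auto
    qed
    also have "\<dots> = integral {x + h..y} U - integral {x..y - h} U"
      using shift_int U_int[of x "y - h"] h by (simp add: Henstock_Kurzweil_Integration.integral_diff shift)
    \<comment> \<open>The common middle part cancels. Only two strips of width \<open>h\<close>
      remain, on which the Lipschitz bound keeps \<open>U\<close> within \<open>L * h\<close> of its
      end values.\<close>
    also have "\<dots> = integral {y - h..y} U - integral {x..x + h} U"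
      using Henstock_Kurzweil_Integration.integral_combine[of x "x + h" y U]
        Henstock_Kurzweil_Integration.integral_combine[of x "y - h" y U] U_int[of x y] h by simp
    also have "\<dots> \<le> h * (U y + L * h) - h * (U x - L * h)"
    proof (rule diff_mono)
      have "integral {y - h..y} U \<le> integral {y - h..y} (\<lambda>t. U y + L * h)"
      proof (rule integral_le)
        show "U t \<le> U y + L * h" if "t \<in> {y - h..y}" for t
        proof -
          have "\<bar>U t - U y\<bar> \<le> L * \<bar>t - y\<bar>" using that h by (intro lip) auto
          also have "\<dots> \<le> L * h" using that L0 by (intro mult_left_mono) auto
          finally show ?thesis by linarith
        qed
      qed (use U_int h in auto)
      then show "integral {y - h..y} U \<le> h * (U y + L * h)" using h by simp
      have "integral {x..x + h} (\<lambda>t. U x - L * h) \<le> integral {x..x + h} U"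
      proof (rule integral_le)
        show "U x - L * h \<le> U t" if "t \<in> {x..x + h}" for t
        proof -
          have "\<bar>U t - U x\<bar> \<le> L * \<bar>t - x\<bar>" using that h by (intro lip) auto
          also have "\<dots> \<le> L * h" using that L0 by (intro mult_left_mono) auto
          finally show ?thesis by linarith
        qed
      qed (use U_int h in auto)
      then show "h * (U x - L * h) \<le> integral {x..x + h} U" using h by simp
    qed
    also have "\<dots> = h * (U y - U x + 2 * L * h)" by (simp add: algebra_simps)
    finally have 1: "integral {x..y - h} q - \<epsilon> * (y - h - x) \<le> U y - U x + 2 * L * h"
      using h by simp
    have "integral {y - h..y} q \<le> integral {y - h..y} (\<lambda>t. L)"
    proof (rule integral_le)
      show "q t \<le> L" if "t \<in> {y - h..y}" for t using bound[of t] that h by auto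
    qed (use qh in auto)
    then have 2: "integral {y - h..y} q \<le> L * h" using h by (simp add: mult.commute)
    have 3: "integral {x..y - h} q + integral {y - h..y} q = integral {x..y} q"
      using q h by (intro Henstock_Kurzweil_Integration.integral_combine) auto
    have "\<epsilon> * (y - h - x) \<le> \<epsilon> * (y - x)" using \<open>\<epsilon> > 0\<close> h by (intro mult_left_mono) auto
    moreover have "L * h \<le> L * \<epsilon>" using L0 h by (intro mult_left_mono)
    ultimately show ?thesis using 1 2 3 by (simp add: algebra_simps)
  qed
  show ?thesis
  proof (rule field_le_epsilon)
    fix e :: real assume "e > 0"
    have pos: "(y - x) + 3 * L > 0" using \<open>x < y\<close> L0 by auto
    show "integral {x..y} q \<le> U y - U x + e"
      using key[of "e / ((y - x) + 3 * L)"] pos \<open>e > 0\<close> by simp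
  qed
qed simp

text \<open>A continuous derivative on a compact interval is uniformly continuous, so one
  \<open>\<delta>\<close> serves all \<open>t\<close>; integrating over \<open>{t..s}\<close> gives
  the bound. It supplies the condition \<open>unif\<close> of
  \<open>integral_le_increment\<close>.\<close>

lemma uniform_derivative_lower_bound:
  fixes g g' :: "real \<Rightarrow> real"
  assumes der: "\<And>t. t \<in> {x..y} \<Longrightarrow> (g has_vector_derivative g' t) (at t within {x..y})"
    and cont: "continuous_on {x..y} g'" and "\<epsilon> > 0"
  shows "\<exists>\<delta>>0. \<forall>t\<in>{x..y}. \<forall>s\<in>{x..y}. t \<le> s \<and> s - t < \<delta> \<longrightarrow> (s - t) * (g' t - \<epsilon>) \<le> g s - g t"
proof -
  have "uniformly_continuous_on {x..y} g'" by (intro compact_uniformly_continuous cont) auto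
  then obtain \<delta> where \<delta>: "\<delta> > 0"
    "\<And>t s. t \<in> {x..y} \<Longrightarrow> s \<in> {x..y} \<Longrightarrow> dist s t < \<delta> \<Longrightarrow> dist (g' s) (g' t) < \<epsilon>"
    using \<open>\<epsilon> > 0\<close> unfolding uniformly_continuous_on_def by blast
  have "(s - t) * (g' t - \<epsilon>) \<le> g s - g t"
    if st: "t \<in> {x..y}" "s \<in> {x..y}" "t \<le> s" "s - t < \<delta>" for t s
  proof -
    have "(g' has_integral (g s - g t)) {t..s}"
      by (rule fundamental_theorem_of_calculus[OF st(3)], rule has_vector_derivative_within_subset[OF der])
        (use st in auto)
    moreover have "((\<lambda>r. g' t - \<epsilon>) has_integral (s - t) * (g' t - \<epsilon>)) {t..s}"
      using has_integral_const_real[of "g' t - \<epsilon>" t s] st by simp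
    moreover have "g' t - \<epsilon> \<le> g' r" if "r \<in> {t..s}" for r
      using \<delta>(2)[of t r] that st by (auto simp: dist_real_def)
    ultimately show ?thesis by (metis has_integral_le)
  qed
  with \<delta>(1) show ?thesis by blast
qed

lemma lipschitz_of_derivative_bound:
  fixes g g' :: "real \<Rightarrow> real"
  assumes der: "\<And>t. t \<in> {x..y} \<Longrightarrow> (g has_vector_derivative g' t) (at t within {x..y})"
    and bd: "\<And>t. t \<in> {x..y} \<Longrightarrow> \<bar>g' t\<bar> \<le> L"
    and "s \<in> {x..y}" "t \<in> {x..y}"
  shows "\<bar>g s - g t\<bar> \<le> L * \<bar>s - t\<bar>"
proof -
  have "norm (g s - g t) \<le> L * norm (s - t)"
  proof (rule differentiable_bound)
    show "(g has_derivative (\<lambda>h. h *\<^sub>R g' r)) (at r within {x..y})" if "r \<in> {x..y}" for r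
      using der[OF that] by (simp add: has_vector_derivative_def)
    show "onorm (\<lambda>h. h *\<^sub>R g' r) \<le> L" if "r \<in> {x..y}" for r
      by (rule onorm_le) (use bd[OF that] in \<open>auto simp: abs_mult mult.commute[of L] intro: mult_left_mono\<close>)
  qed (use assms in auto)
  then show ?thesis by simp
qed

text \<open>Here \<open>\<alpha>\<close> stands for the weights of a mechanism and \<open>U\<close>
  for the utility left to each type; the subgradient inequality is then incentive compatibility,
  with \<open>s\<close> imitating \<open>t\<close>. Averaging the uniform bounds for the finitely
  many \<open>V b\<close> yields what \<open>integral_le_increment\<close> asks of
  \<open>U\<close>.\<close>

lemma envelope_lower_bound:
  fixes U :: "real \<Rightarrow> real" and \<alpha> V V' :: "'b \<Rightarrow> real \<Rightarrow> real"
  assumes xy: "x \<le> y" and K: "finite K"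
    and der: "\<And>b t. b \<in> K \<Longrightarrow> t \<in> {x..y} \<Longrightarrow> (V b has_vector_derivative V' b t) (at t within {x..y})"
    and cont: "\<And>b. b \<in> K \<Longrightarrow> continuous_on {x..y} (V' b)"
    and \<alpha>0: "\<And>b t. b \<in> K \<Longrightarrow> t \<in> {x..y} \<Longrightarrow> 0 \<le> \<alpha> b t"
    and \<alpha>1: "\<And>t. t \<in> {x..y} \<Longrightarrow> (\<Sum>b\<in>K. \<alpha> b t) = 1"
    and int: "(\<lambda>t. \<Sum>b\<in>K. \<alpha> b t * V' b t) integrable_on {x..y}"
    and subgradient: "\<And>s t. s \<in> {x..y} \<Longrightarrow> t \<in> {x..y} \<Longrightarrow>
       (\<Sum>b\<in>K. \<alpha> b t * (V b s - V b t)) \<le> U s - U t"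
  shows "integral {x..y} (\<lambda>t. \<Sum>b\<in>K. \<alpha> b t * V' b t) \<le> U y - U x"
proof -
  have "\<exists>L. \<forall>b\<in>K. \<forall>t\<in>{x..y}. \<bar>V' b t\<bar> \<le> L"
  proof -
    have "compact (\<Union>b\<in>K. V' b ` {x..y})"
      using K by (intro compact_UN) (auto intro!: compact_continuous_image cont)
    then obtain L where "\<forall>r\<in>(\<Union>b\<in>K. V' b ` {x..y}). norm r \<le> L"
      using compact_imp_bounded bounded_iff by blast
    then show ?thesis by auto
  qed
  then obtain L where L: "\<And>b t. b \<in> K \<Longrightarrow> t \<in> {x..y} \<Longrightarrow> \<bar>V' b t\<bar> \<le> L" by blast
  have avg: "\<bar>\<Sum>b\<in>K. \<alpha> b t * c b\<bar> \<le> M" if "t \<in> {x..y}" "\<And>b. b \<in> K \<Longrightarrow> \<bar>c b\<bar> \<le> M" for t c M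
  proof -
    have "\<bar>\<Sum>b\<in>K. \<alpha> b t * c b\<bar> \<le> (\<Sum>b\<in>K. \<alpha> b t * M)"
      by (rule order_trans[OF sum_abs sum_mono]) (use that \<alpha>0 in \<open>auto simp: abs_mult mult_left_mono\<close>)
    also have "\<dots> = M" using \<alpha>1[OF that(1)] by (simp flip: sum_distrib_right)
    finally show ?thesis .
  qed
  \<comment> \<open>Exchanging the roles of \<open>s\<close> and \<open>t\<close> turns this
    one-sided bound into the Lipschitz condition.\<close>
  have Ulow: "- (L * \<bar>s - t\<bar>) \<le> U s - U t" if "s \<in> {x..y}" "t \<in> {x..y}" for s t
  proof -
    have "\<bar>\<Sum>b\<in>K. \<alpha> b t * (V b s - V b t)\<bar> \<le> L * \<bar>s - t\<bar>"
      by (rule avg) (use that lipschitz_of_derivative_bound[OF der L] in auto)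
    then show ?thesis using subgradient[OF that] by linarith
  qed
  show ?thesis
  proof (rule integral_le_increment[OF xy _ int])
    show "\<bar>U s - U t\<bar> \<le> L * \<bar>s - t\<bar>" if "s \<in> {x..y}" "t \<in> {x..y}" for s t
      using Ulow[OF that] Ulow[OF that(2,1)] by (simp add: abs_minus_commute)
    show "\<bar>\<Sum>b\<in>K. \<alpha> b t * V' b t\<bar> \<le> L" if "t \<in> {x..y}" for t
      using avg[OF that] L that by simp
    fix \<epsilon> :: real assume "\<epsilon> > 0"
    have "\<forall>b\<in>K. \<exists>\<delta>>0. \<forall>t\<in>{x..y}. \<forall>s\<in>{x..y}.
        t \<le> s \<and> s - t < \<delta> \<longrightarrow> (s - t) * (V' b t - \<epsilon>) \<le> V b s - V b t"
      using uniform_derivative_lower_bound[OF der cont \<open>\<epsilon> > 0\<close>] by blast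
    then obtain \<delta> where \<delta>: "\<And>b. b \<in> K \<Longrightarrow> \<delta> b > 0"
      "\<And>b t s. b \<in> K \<Longrightarrow> t \<in> {x..y} \<Longrightarrow> s \<in> {x..y} \<Longrightarrow> t \<le> s \<Longrightarrow> s - t < \<delta> b \<Longrightarrow>
         (s - t) * (V' b t - \<epsilon>) \<le> V b s - V b t"
      by metis
    \<comment> \<open>The element 1 makes the set nonempty whatever \<open>K\<close> is, so
      \<open>Min\<close> is always meaningful.\<close>
    define \<delta>0 where "\<delta>0 = Min (insert 1 (\<delta> ` K))"
    have "\<delta>0 > 0" using K \<delta>(1) by (auto simp: \<delta>0_def)
    moreover have le: "\<delta>0 \<le> \<delta> b" if "b \<in> K" for b using K that by (auto simp: \<delta>0_def)
    moreover have "(s - t) * ((\<Sum>b\<in>K. \<alpha> b t * V' b t) - \<epsilon>) \<le> U s - U t"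
      if st: "t \<in> {x..y}" "s \<in> {x..y}" "t \<le> s" "s - t < \<delta>0" for s t
    proof -
      have "(s - t) * ((\<Sum>b\<in>K. \<alpha> b t * V' b t) - \<epsilon>) =
          (s - t) * ((\<Sum>b\<in>K. \<alpha> b t * V' b t) - (\<Sum>b\<in>K. \<alpha> b t) * \<epsilon>)"
        using \<alpha>1[OF st(1)] by simp
      also have "\<dots> = (\<Sum>b\<in>K. \<alpha> b t * ((s - t) * (V' b t - \<epsilon>)))"
        unfolding sum_distrib_right sum_subtractf[symmetric] sum_distrib_left
        by (intro sum.cong refl) (simp add: algebra_simps)
      also have "\<dots> \<le> (\<Sum>b\<in>K. \<alpha> b t * (V b s - V b t))"
        using \<delta>(2) st le \<alpha>0 by (intro sum_mono mult_left_mono) force+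
      also have "\<dots> \<le> U s - U t" using subgradient st by blast
      finally show ?thesis .
    qed
    ultimately show "\<exists>\<delta>>0. \<forall>t\<in>{x..y}. \<forall>s\<in>{x..y}. t \<le> s \<and> s - t < \<delta> \<longrightarrow>
        (s - t) * ((\<Sum>b\<in>K. \<alpha> b t * V' b t) - \<epsilon>) \<le> U s - U t"
      by blast
  qed
qed

lemma continuous_on_Max_image:
  fixes g :: "'b \<Rightarrow> 'a::topological_space \<Rightarrow> real"
  assumes "finite B" "B \<noteq> {}" "\<And>b. b \<in> B \<Longrightarrow> continuous_on S (g b)"
  shows "continuous_on S (\<lambda>t. Max ((\<lambda>b. g b t) ` B))"
  using assms
proof (induction B rule: finite_ne_induct)
  case (insert b B)
  then have "continuous_on S (\<lambda>t. max (g b t) (Max ((\<lambda>b. g b t) ` B)))"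
    by (intro continuous_on_max) auto
  with insert.hyps show ?case by simp
qed simp

section \<open>Type distribution, integrals over types and continuity of virtual values\<close>

context monopoly
begin

lemma finite_bundles: "finite bundles" and empty_in_bundles: "{} \<in> bundles"
  by (auto simp: bundles_def)

lemma tl_in_T: "tl \<in> T" and th_in_T: "th \<in> T"
  using tl_less_th by (auto simp: T_def)

lemma v_has_derivative:
  "b \<in> bundles \<Longrightarrow> t \<in> T \<Longrightarrow> (v b has_vector_derivative v_t b t) (at t within T)"
  using v_differentiable[of b] by (auto simp: v_t_def differentiable_on_def vector_derivative_works)

lemma v_continuous: "b \<in> bundles \<Longrightarrow> continuous_on T (v b)"
  using v_differentiable by (blast intro: differentiable_imp_continuous_on)

lemma continuous_bounded_on_T:
  fixes g :: "real \<Rightarrow> real"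
  assumes "continuous_on T g"
  obtains M where "\<And>t. t \<in> T \<Longrightarrow> \<bar>g t\<bar> \<le> M"
proof -
  have "bounded (g ` T)"
    using assms by (intro compact_imp_bounded compact_continuous_image) (auto simp: T_def)
  then show ?thesis using that by (auto simp: bounded_iff)
qed

lemma sets_type_dist [measurable_cong]: "sets type_dist = sets (restrict_space borel T)"
  by (simp add: type_dist_def cong: sets_restrict_space_cong)

lemma space_type_dist: "space type_dist = T"
  by (simp add: type_dist_def space_restrict_space)

lemma measurable_lborel_T:
  "g \<in> borel_measurable (restrict_space lborel T) \<longleftrightarrow> g \<in> borel_measurable (restrict_space borel T)"
proof -
  have "sets (restrict_space lborel T) = sets (restrict_space borel T)"
    by (rule sets_restrict_space_cong) simp
  then show ?thesis using measurable_cong_sets by blast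
qed

lemma f_measurable: "f \<in> borel_measurable (restrict_space borel T)"
  by (rule borel_measurable_continuous_on_restrict[OF f_continuous])

lemma integral_type_dist:
  fixes g :: "real \<Rightarrow> real"
  assumes "g \<in> borel_measurable (restrict_space borel T)"
  shows "integral\<^sup>L type_dist g = integral\<^sup>L (restrict_space lborel T) (\<lambda>t. f t * g t)"
  unfolding type_dist_def
  by (subst integral_density)
    (use assms f_measurable f_positive in \<open>auto simp: measurable_lborel_T less_imp_le AE_restrict_space_iff T_def\<close>)

text \<open>Passage between the three integrals in play: the gauge integral, which supports the
  calculus, the Lebesgue integral on \<open>T\<close>, and the expectation over types. Bounded
  measurable functions qualify for all of them, as \<open>T\<close> has finite length and the type
  distribution has mass 1.\<close>

lemma
  fixes g :: "real \<Rightarrow> real"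
  assumes g: "g \<in> borel_measurable (restrict_space borel T)" and M: "\<And>t. t \<in> T \<Longrightarrow> \<bar>g t\<bar> \<le> M"
  shows bounded_integrable_on: "g integrable_on T"
    and integral_lborel_T: "integral\<^sup>L (restrict_space lborel T) g = integral T g"
    and bounded_integrable_type_dist: "integrable type_dist g"
proof -
  have "(\<lambda>t. indicator T t *\<^sub>R g t) \<in> borel_measurable borel"
    using g by (subst (asm) borel_measurable_restrict_space_iff) (auto simp: T_def)
  then have *: "set_integrable lborel T g"
    unfolding set_integrable_def
    by (intro integrableI_bounded_set[where A = T and B = M])
      (use M in \<open>auto simp: T_def emeasure_lborel_Icc_eq\<close>)
  then show "g integrable_on T" by (rule set_borel_integral_eq_integral)
  show "integral\<^sup>L (restrict_space lborel T) g = integral T g"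
    using set_borel_integral_eq_integral(2)[OF *]
    by (subst integral_restrict_space) (auto simp: T_def set_lebesgue_integral_def)
  interpret prob_space type_dist by (rule prob_type_dist)
  show "integrable type_dist g"
    by (rule integrable_const_bound[of _ M]) (use g M in \<open>auto simp: space_type_dist cong: measurable_cong_sets[OF sets_type_dist refl]\<close>)
qed

lemma integral_type_dist_HK:
  fixes g :: "real \<Rightarrow> real"
  assumes g: "g \<in> borel_measurable (restrict_space borel T)" and M: "\<And>t. t \<in> T \<Longrightarrow> \<bar>g t\<bar> \<le> M"
  shows "integral\<^sup>L type_dist g = integral T (\<lambda>t. f t * g t)"
proof -
  obtain C where C: "\<And>t. t \<in> T \<Longrightarrow> \<bar>f t\<bar> \<le> C" using continuous_bounded_on_T[OF f_continuous] by blast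
  have "(\<lambda>t. f t * g t) \<in> borel_measurable (restrict_space borel T)"
    using f_measurable g by measurable
  moreover have "\<bar>f t * g t\<bar> \<le> C * M" if "t \<in> T" for t
    unfolding abs_mult by (rule mult_mono) (use C[OF that] M[OF that] in auto)
  ultimately show ?thesis
    using integral_type_dist[OF g] integral_lborel_T[of "\<lambda>t. f t * g t" "C * M"] by simp
qed

lemma integral_T_restrict:
  fixes g :: "real \<Rightarrow> real"
  assumes "{x..y} \<subseteq> T"
  shows "integral T (\<lambda>t. if t \<in> {x..y} then g t else 0) = integral {x..y} g"
  using assms by (subst integral_restrict_Int) (simp add: Int_absorb2)

text \<open>Turns the distribution function into an indefinite integral, from which its continuity
  and the tail mass \<open>1 - F t\<close> are read off.\<close>

lemma F_eq:
  assumes "t \<in> T" shows "F t = integral {tl..t} f"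
proof -
  interpret prob_space type_dist by (rule prob_type_dist)
  have "{s \<in> T. s \<le> t} = {tl..t}" using assms by (auto simp: T_def)
  moreover have meas: "{tl..t} \<in> sets type_dist"
    using assms by (auto simp: sets_type_dist sets_restrict_space T_def intro!: image_eqI[of _ _ "{tl..t}"])
  moreover have "indicator {tl..t} \<in> borel_measurable (restrict_space borel T)"
    by (intro measurable_restrict_space1 borel_measurable_indicator) auto
  ultimately have "F t = integral T (\<lambda>s. f s * indicator {tl..t} s)"
    unfolding F_def
    by (subst integral_type_dist_HK[where M = 1, symmetric]) auto
  also have "(\<lambda>s. f s * indicator {tl..t} s) = (\<lambda>s. if s \<in> {tl..t} then f s else 0)"
    by (auto simp: indicator_def)
  finally show ?thesis using assms by (subst (asm) integral_T_restrict) (auto simp: T_def)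
qed

lemma f_integrable: "f integrable_on T"
  using integrable_continuous_real f_continuous by (auto simp: T_def)

lemma F_continuous: "continuous_on T F"
  by (rule continuous_on_eq[of _ "\<lambda>t. integral {tl..t} f"])
    (use indefinite_integral_continuous_1 f_integrable F_eq in \<open>auto simp: T_def\<close>)

lemma F_th: "F th = 1"
proof -
  have "{s \<in> T. s \<le> th} = space type_dist" by (auto simp: space_type_dist T_def)
  then show ?thesis using prob_space.prob_space[OF prob_type_dist] by (simp add: F_def)
qed

lemma F_le_1: "F t \<le> 1"
  unfolding F_def by (rule prob_space.prob_le_1[OF prob_type_dist])

lemma integral_f_upper: "t \<in> T \<Longrightarrow> integral {t..th} f = 1 - F t"
  using Henstock_Kurzweil_Integration.integral_combine[of tl t th f] f_integrable F_eq[of t] F_eq[OF th_in_T] F_th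
  by (auto simp: T_def)

lemma \<phi>_continuous: "b \<in> bundles \<Longrightarrow> continuous_on T (\<phi> b)"
  unfolding \<phi>_def using f_positive
  by (intro continuous_intros v_continuous F_continuous f_continuous v_t_continuous) force+

section \<open>Expected information rent by exchanging the order of integration\<close>

text \<open>The marginal rent \<open>q s\<close> accrues to every type above \<open>s\<close>.
  Exchanging the integrals over the triangle \<open>s \<le> t\<close> weights it with the mass
  \<open>1 - F s\<close> of these types, and writing the outer integral as an expectation over types
  brings in \<open>1 / f s\<close>.\<close>

lemma integral_information_rent:
  fixes q :: "real \<Rightarrow> real"
  assumes q: "q \<in> borel_measurable (restrict_space borel T)" and M: "\<And>t. t \<in> T \<Longrightarrow> \<bar>q t\<bar> \<le> M"
  shows "(\<integral>t. integral {tl..t} q \<partial>type_dist) = (\<integral>t. (1 - F t) / f t * q t \<partial>type_dist)"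
proof -
  let ?N = "restrict_space lborel T"
  define k where "k s t = (if s \<le> t then q s else 0)" for s t :: real
  interpret M: prob_space type_dist by (rule prob_type_dist)
  interpret N: finite_measure ?N
    by (rule finite_measureI) (simp add: emeasure_restrict_space T_def space_restrict_space emeasure_lborel_Icc_eq)
  interpret MN: pair_sigma_finite ?N type_dist ..
  have [measurable]: "q \<in> borel_measurable ?N" using q by (simp add: measurable_lborel_T)
  have id: "(\<lambda>t. t) \<in> borel_measurable type_dist" "(\<lambda>t. t) \<in> borel_measurable ?N"
    by (auto intro: measurable_restrict_space1 simp: measurable_cong_sets[OF sets_type_dist refl] measurable_lborel_T)
  \<comment> \<open>To compare the two coordinates, they are needed as Borel real functions and not
    only as maps into the restricted spaces.\<close>
  have [measurable]: "fst \<in> borel_measurable (?N \<Otimes>\<^sub>M type_dist)" "snd \<in> borel_measurable (?N \<Otimes>\<^sub>M type_dist)"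
    using measurable_compose[OF measurable_fst id(2), of type_dist] measurable_compose[OF measurable_snd id(1), of ?N] by simp_all
  interpret P: finite_measure "?N \<Otimes>\<^sub>M type_dist"
    by (rule finite_measure_pair_measure) unfold_locales
  have "integrable (?N \<Otimes>\<^sub>M type_dist) (case_prod k)"
  proof (rule P.integrable_const_bound[of _ M])
    show "AE x in ?N \<Otimes>\<^sub>M type_dist. norm (case_prod k x) \<le> M"
      using M by (intro AE_I2) (force simp: k_def space_pair_measure space_restrict_space)
    have "(\<lambda>x. if fst x \<le> snd x then q (fst x) else 0) \<in> borel_measurable (?N \<Otimes>\<^sub>M type_dist)"
      by measurable
    then show "case_prod k \<in> borel_measurable (?N \<Otimes>\<^sub>M type_dist)"
      by (simp add: k_def case_prod_beta')
  qed
  note fubini = MN.Fubini_integral[OF this]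
  have M0: "M \<ge> 0" using M[OF tl_in_T] by simp
  have inner1: "(\<integral>s. k s t \<partial>?N) = integral {tl..t} q" if "t \<in> T" for t
  proof -
    have "(\<lambda>s. if s \<le> t then q s else 0) \<in> borel_measurable (restrict_space borel T)"
      using q measurable_restrict_space1[OF measurable_ident, of borel T]
      by (intro measurable_If) (auto intro!: borel_measurable_pred_less simp: id_def)
    then have "(\<integral>s. k s t \<partial>?N) = integral T (\<lambda>s. if s \<le> t then q s else 0)"
      unfolding k_def by (rule integral_lborel_T[of _ M]) (use M M0 in auto)
    also have "\<dots> = integral T (\<lambda>s. if s \<in> {tl..t} then q s else 0)"
      by (intro Henstock_Kurzweil_Integration.integral_cong) (auto simp: T_def)
    finally show ?thesis using that by (subst (asm) integral_T_restrict) (auto simp: T_def)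
  qed
  have inner2: "(\<integral>t. k s t \<partial>type_dist) = q s * (1 - F s)" if "s \<in> T" for s
  proof -
    have "(\<lambda>t. if s \<le> t then q s else 0) \<in> borel_measurable (restrict_space borel T)"
      by (intro measurable_restrict_space1) measurable
    then have "(\<integral>t. k s t \<partial>type_dist) = integral T (\<lambda>t. f t * (if s \<le> t then q s else 0))"
      unfolding k_def by (rule integral_type_dist_HK[of _ M]) (use M that M0 in auto)
    also have "\<dots> = integral T (\<lambda>t. if t \<in> {s..th} then q s * f t else 0)"
      by (intro Henstock_Kurzweil_Integration.integral_cong) (auto simp: T_def)
    finally show ?thesis using that integral_f_upper[OF that]
      by (subst (asm) integral_T_restrict) (auto simp: T_def)
  qed
  have "(\<integral>t. integral {tl..t} q \<partial>type_dist) = (\<integral>t. \<integral>s. k s t \<partial>?N \<partial>type_dist)"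
    by (intro Bochner_Integration.integral_cong refl) (simp add: inner1 space_type_dist)
  also have "\<dots> = (\<integral>s. \<integral>t. k s t \<partial>type_dist \<partial>?N)" by (rule fubini)
  also have "\<dots> = (\<integral>s. f s * ((1 - F s) / f s * q s) \<partial>?N)"
    using f_positive by (intro Bochner_Integration.integral_cong refl) (force simp: inner2 space_restrict_space)
  also have "\<dots> = (\<integral>t. (1 - F t) / f t * q t \<partial>type_dist)"
    using q f_measurable borel_measurable_continuous_on_restrict[OF F_continuous]
    by (intro integral_type_dist[symmetric]) measurable
  finally show ?thesis .
qed

section \<open>Upper envelopes of virtual values over a menu\<close>

text \<open>Taken relative to a menu: \<open>envelope bundles\<close> is the integrand of the
  upper-envelope problem, and a smaller \<open>B\<close> gives the revenue bound for mechanisms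
  confined to \<open>B\<close>.\<close>

definition envelope :: "nat set set \<Rightarrow> real \<Rightarrow> real" where
  "envelope B t = Max ((\<lambda>b. \<phi> b t) ` B)"

lemma envelope_continuous:
  "B \<subseteq> bundles \<Longrightarrow> B \<noteq> {} \<Longrightarrow> continuous_on T (envelope B)"
  unfolding envelope_def
  by (intro continuous_on_Max_image \<phi>_continuous) (auto intro: finite_subset[OF _ finite_bundles])

lemma \<phi>_le_envelope: "B \<subseteq> bundles \<Longrightarrow> b \<in> B \<Longrightarrow> \<phi> b t \<le> envelope B t"
  unfolding envelope_def by (intro Max_ge finite_imageI finite_subset[OF _ finite_bundles]) auto

lemma envelope_mono: "B \<subseteq> bundles \<Longrightarrow> B \<noteq> {} \<Longrightarrow> envelope B t \<le> envelope bundles t"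
  unfolding envelope_def by (intro Max_mono) (auto simp: finite_bundles)

lemma argmax_\<phi>_iff: "b \<in> argmax_\<phi> t \<longleftrightarrow> b \<in> bundles \<and> (\<forall>c\<in>bundles. \<phi> c t \<le> \<phi> b t)"
  by (auto simp: argmax_\<phi>_def is_arg_max_linorder)

lemma envelope_eq_argmax: "b \<in> argmax_\<phi> t \<Longrightarrow> envelope bundles t = \<phi> b t"
  unfolding envelope_def argmax_\<phi>_iff by (intro Max_eqI) (auto simp: finite_bundles)

lemma continuous_integrable_type_dist:
  fixes g :: "real \<Rightarrow> real"
  assumes "continuous_on T g"
  shows "integrable type_dist g"
proof -
  obtain M where "\<And>t. t \<in> T \<Longrightarrow> \<bar>g t\<bar> \<le> M" using continuous_bounded_on_T[OF assms] by blast
  then show ?thesis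
    by (rule bounded_integrable_type_dist[OF borel_measurable_continuous_on_restrict[OF assms]])
qed

section \<open>Stochastic mechanisms and the upper bound on revenue\<close>

lemma
  assumes "a \<in> stochastic_bundles"
  shows value_of_eq: "value_of a t = (\<Sum>b\<in>bundles. pmf a b * v b t)"
    and weights_sum: "(\<Sum>b\<in>bundles. pmf a b) = 1"
proof -
  show "value_of a t = (\<Sum>b\<in>bundles. pmf a b * v b t)"
    unfolding value_of_def
    by (subst integral_measure_pmf[OF finite_bundles]) (use assms in \<open>auto simp: stochastic_bundles_def\<close>)
  show "(\<Sum>b\<in>bundles. pmf a b) = 1"
    using assms by (intro sum_pmf_eq_1) (auto simp: finite_bundles stochastic_bundles_def)
qed

text \<open>Weights are at most 1, so the sum of all \<open>\<bar>g b t\<bar>\<close> dominates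
  every weighted sum. The constant depends neither on \<open>a\<close> nor on
  \<open>t\<close>.\<close>

lemma weighted_sum_bounded:
  assumes "\<And>b. b \<in> bundles \<Longrightarrow> continuous_on T (g b)"
  obtains M :: real where
    "\<And>a t. a \<in> stochastic_bundles \<Longrightarrow> t \<in> T \<Longrightarrow> \<bar>\<Sum>b\<in>bundles. pmf a b * g b t\<bar> \<le> M"
proof -
  have "continuous_on T (\<lambda>t. \<Sum>b\<in>bundles. \<bar>g b t\<bar>)"
    using assms by (intro continuous_intros)
  then obtain M where M: "\<And>t. t \<in> T \<Longrightarrow> \<bar>\<Sum>b\<in>bundles. \<bar>g b t\<bar>\<bar> \<le> M"
    using continuous_bounded_on_T by blast
  have "\<bar>\<Sum>b\<in>bundles. pmf a b * g b t\<bar> \<le> M" if "t \<in> T" for a t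
  proof -
    have "\<bar>\<Sum>b\<in>bundles. pmf a b * g b t\<bar> \<le> (\<Sum>b\<in>bundles. \<bar>g b t\<bar>)"
      by (rule order_trans[OF sum_abs sum_mono])
        (auto simp: abs_mult pmf_nonneg pmf_le_1 mult_left_le_one_le)
    also have "\<dots> \<le> M" using M[OF that] by linarith
    finally show ?thesis .
  qed
  then show ?thesis using that by blast
qed

lemma weighted_sum_measurable:
  assumes "mechanism a p" "\<And>b. b \<in> bundles \<Longrightarrow> continuous_on T (g b)"
  shows "(\<lambda>t. \<Sum>b\<in>bundles. pmf (a t) b * g b t :: real) \<in> borel_measurable (restrict_space borel T)"
  using assms borel_measurable_continuous_on_restrict
  by (intro borel_measurable_sum borel_measurable_times) (auto simp: mechanism_def)

text \<open>The incentive constraints between \<open>t\<close> and \<open>tl\<close>, in both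
  directions, confine \<open>p t - p tl\<close> between differences of values, which are uniformly
  bounded.\<close>

lemma payment_integrable:
  assumes "mechanism a p" "IC a p"
  shows "integrable type_dist p"
proof -
  obtain M where M: "\<And>a t. a \<in> stochastic_bundles \<Longrightarrow> t \<in> T \<Longrightarrow> \<bar>value_of a t\<bar> \<le> M"
    using weighted_sum_bounded[of v, OF v_continuous] by (auto simp: value_of_eq)
  have a: "a t \<in> stochastic_bundles" if "t \<in> T" for t using assms that by (auto simp: mechanism_def)
  have "\<bar>p t\<bar> \<le> \<bar>p tl\<bar> + 2 * M" if t: "t \<in> T" for t
  proof -
    have "value_of (a t) t - p t \<ge> value_of (a tl) t - p tl"
      "value_of (a tl) tl - p tl \<ge> value_of (a t) tl - p t"
      using assms t tl_in_T by (auto simp: IC_def)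
    then show ?thesis
      using M[OF a[OF t] t] M[OF a[OF t] tl_in_T] M[OF a[OF tl_in_T] t] M[OF a[OF tl_in_T] tl_in_T]
      by linarith
  qed
  then show ?thesis using assms(1)
    by (intro bounded_integrable_type_dist) (auto simp: mechanism_def)
qed

text \<open>The product \<open>(1 - F t) / f t * q t\<close> is exactly value minus virtual value.
  By \<open>integral_information_rent\<close>, expected value net of rents is therefore expected
  virtual value.\<close>

lemma surplus_minus_rent:
  assumes mech: "mechanism a p"
  defines "q \<equiv> \<lambda>t. \<Sum>b\<in>bundles. pmf (a t) b * v_t b t"
  shows "integrable type_dist (\<lambda>t. value_of (a t) t - integral {tl..t} q)"
    and "(\<integral>t. value_of (a t) t - integral {tl..t} q \<partial>type_dist) =
      (\<integral>t. (\<Sum>b\<in>bundles. pmf (a t) b * \<phi> b t) \<partial>type_dist)"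
    and "integrable type_dist (\<lambda>t. \<Sum>b\<in>bundles. pmf (a t) b * \<phi> b t)"
    and "q integrable_on T"
proof -
  have a: "a t \<in> stochastic_bundles" if "t \<in> T" for t using mech that by (auto simp: mechanism_def)
  have bdd: "\<exists>M. \<forall>t\<in>T. \<bar>\<Sum>b\<in>bundles. pmf (a t) b * g b t\<bar> \<le> M"
    if "\<And>b. b \<in> bundles \<Longrightarrow> continuous_on T (g b)" for g :: "nat set \<Rightarrow> real \<Rightarrow> real"
    using weighted_sum_bounded[of g] that a by metis
  have int: "integrable type_dist (\<lambda>t. \<Sum>b\<in>bundles. pmf (a t) b * g b t)"
    if "\<And>b. b \<in> bundles \<Longrightarrow> continuous_on T (g b)" for g :: "nat set \<Rightarrow> real \<Rightarrow> real"
    using bdd[of g] bounded_integrable_type_dist[OF weighted_sum_measurable[OF mech, of g]] that by blast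
  obtain M where M: "\<And>t. t \<in> T \<Longrightarrow> \<bar>q t\<bar> \<le> M" using bdd[of v_t, OF v_t_continuous] by (auto simp: q_def)
  have q: "q \<in> borel_measurable (restrict_space borel T)"
    unfolding q_def by (rule weighted_sum_measurable[OF mech, of v_t, OF v_t_continuous])
  show qi: "q integrable_on T" by (rule bounded_integrable_on[OF q M])
  have rent: "integrable type_dist (\<lambda>t. integral {tl..t} q)"
    using continuous_integrable_type_dist[of "\<lambda>t. integral {tl..t} q"] indefinite_integral_continuous_1[of q tl th] qi
    by (simp add: T_def)
  have value_int: "integrable type_dist (\<lambda>t. value_of (a t) t)"
    using int[of v, OF v_continuous] a
    by (subst Bochner_Integration.integrable_cong[OF refl, of _ _ "\<lambda>t. \<Sum>b\<in>bundles. pmf (a t) b * v b t"])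
       (auto simp: value_of_eq space_type_dist)
  show "integrable type_dist (\<lambda>t. value_of (a t) t - integral {tl..t} q)"
    using value_int rent by simp
  show \<phi>_int: "integrable type_dist (\<lambda>t. \<Sum>b\<in>bundles. pmf (a t) b * \<phi> b t)"
    by (rule int[of \<phi>, OF \<phi>_continuous])
  have eq: "(1 - F t) / f t * q t = value_of (a t) t - (\<Sum>b\<in>bundles. pmf (a t) b * \<phi> b t)" if "t \<in> T" for t
    unfolding q_def value_of_eq[OF a[OF that]] sum_distrib_left sum_subtractf[symmetric]
    by (intro sum.cong refl) (simp add: \<phi>_def right_diff_distrib)
  have "(\<integral>t. integral {tl..t} q \<partial>type_dist) = (\<integral>t. (1 - F t) / f t * q t \<partial>type_dist)"
    by (rule integral_information_rent[OF q M])
  also have "\<dots> = (\<integral>t. value_of (a t) t - (\<Sum>b\<in>bundles. pmf (a t) b * \<phi> b t) \<partial>type_dist)"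
    using eq by (intro Bochner_Integration.integral_cong refl) (simp add: space_type_dist)
  finally show "(\<integral>t. value_of (a t) t - integral {tl..t} q \<partial>type_dist) =
      (\<integral>t. (\<Sum>b\<in>bundles. pmf (a t) b * \<phi> b t) \<partial>type_dist)"
    using value_int rent \<phi>_int by simp
qed

text \<open>By \<open>envelope_lower_bound\<close> and individual rationality at \<open>tl\<close>,
  type \<open>t\<close> keeps at least the rent \<open>integral {tl..t} q\<close>, so
  \<open>p t\<close> is at most value net of this rent. In expectation this is an average of virtual
  values over bundles in \<open>B\<close>, hence below their maximum.\<close>

lemma revenue_le_envelope:
  assumes mech: "mechanism a p" and IC: "IC a p" and IR: "IR a p"
    and B: "B \<subseteq> bundles" "\<And>t. t \<in> T \<Longrightarrow> set_pmf (a t) \<subseteq> B"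
  shows "revenue p \<le> integral\<^sup>L type_dist (envelope B)"
proof -
  define q where "q t = (\<Sum>b\<in>bundles. pmf (a t) b * v_t b t)" for t
  define U where "U t = value_of (a t) t - p t" for t
  have a: "a t \<in> stochastic_bundles" if "t \<in> T" for t using mech that by (auto simp: mechanism_def)
  have q_int: "q integrable_on T" using surplus_minus_rent(4)[OF mech] by (simp add: q_def[abs_def])
  have p_le: "p t \<le> value_of (a t) t - integral {tl..t} q" if t: "t \<in> T" for t
  proof -
    have sub: "{tl..t} \<subseteq> T" using t by (auto simp: T_def)
    have "integral {tl..t} (\<lambda>t. \<Sum>b\<in>bundles. pmf (a t) b * v_t b t) \<le> U t - U tl"
    proof (rule envelope_lower_bound[where V = v])
      show "(v b has_vector_derivative v_t b s) (at s within {tl..t})" if "b \<in> bundles" "s \<in> {tl..t}" for b s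
        using that sub by (intro has_vector_derivative_within_subset[OF v_has_derivative]) auto
      show "continuous_on {tl..t} (v_t b)" if "b \<in> bundles" for b
        by (rule continuous_on_subset[OF v_t_continuous[OF that] sub])
      show "(\<lambda>t. \<Sum>b\<in>bundles. pmf (a t) b * v_t b t) integrable_on {tl..t}"
        using integrable_on_subinterval[OF q_int sub] by (simp add: q_def[abs_def])
      fix r s assume "r \<in> {tl..t}" "s \<in> {tl..t}"
      then have rs: "r \<in> T" "s \<in> T" using sub by auto
      then have "value_of (a s) r - value_of (a s) s \<le> U r - U s"
        using IC by (force simp: IC_def U_def)
      then show "(\<Sum>b\<in>bundles. pmf (a s) b * (v b r - v b s)) \<le> U r - U s"
        by (simp add: value_of_eq a rs right_diff_distrib sum_subtractf)
    qed (use t sub a in \<open>auto simp: finite_bundles weights_sum T_def\<close>)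
    moreover have "U tl \<ge> 0" using IR tl_in_T by (simp add: IR_def U_def)
    ultimately show ?thesis by (simp add: U_def q_def[abs_def])
  qed
  have "revenue p \<le> (\<integral>t. value_of (a t) t - integral {tl..t} q \<partial>type_dist)"
    unfolding revenue_def
    by (intro integral_mono payment_integrable[OF mech IC] surplus_minus_rent(1)[OF mech, folded q_def])
      (simp add: p_le space_type_dist)
  also have "\<dots> = (\<integral>t. (\<Sum>b\<in>bundles. pmf (a t) b * \<phi> b t) \<partial>type_dist)"
    by (rule surplus_minus_rent(2)[OF mech, folded q_def])
  also have "\<dots> \<le> integral\<^sup>L type_dist (envelope B)"
  proof (rule integral_mono)
    have "B \<noteq> {}" using B(2)[OF tl_in_T] set_pmf_not_empty[of "a tl"] by blast
    then show "integrable type_dist (envelope B)"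
      using B by (intro continuous_integrable_type_dist envelope_continuous)
    show "(\<Sum>b\<in>bundles. pmf (a t) b * \<phi> b t) \<le> envelope B t" if "t \<in> space type_dist" for t
    proof -
      have t: "t \<in> T" using that by (simp add: space_type_dist)
      have "(\<Sum>b\<in>bundles. pmf (a t) b * \<phi> b t) \<le> (\<Sum>b\<in>bundles. pmf (a t) b * envelope B t)"
      proof (rule sum_mono)
        fix b assume "b \<in> bundles"
        show "pmf (a t) b * \<phi> b t \<le> pmf (a t) b * envelope B t"
          using \<phi>_le_envelope[OF B(1), of b t] B(2)[OF t]
          by (cases "b \<in> set_pmf (a t)") (auto simp: mult_left_mono set_pmf_iff)
      qed
      then show ?thesis using weights_sum[OF a[OF t]] by (simp flip: sum_distrib_right)
    qed
  qed (rule surplus_minus_rent(3)[OF mech])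
  finally show ?thesis .
qed

text \<open>The gap between the two envelopes is continuous and nonnegative, and its integral
  against the positive density is zero. So it vanishes at every type, not just almost everywhere,
  and the best bundle of \<open>B\<close> at \<open>t\<close> is a best bundle overall.\<close>

lemma envelope_optimal_if_integral_eq:
  assumes B: "B \<subseteq> bundles" "B \<noteq> {}"
    and le: "integral\<^sup>L type_dist (envelope bundles) \<le> integral\<^sup>L type_dist (envelope B)"
  shows "envelope_optimal_menu B"
proof -
  define gap where "gap t = envelope bundles t - envelope B t" for t
  have cB: "continuous_on T (envelope B)" "continuous_on T (envelope bundles)"
    using B empty_in_bundles by (auto intro!: envelope_continuous)
  then have cgap: "continuous_on T gap" unfolding gap_def by (intro continuous_intros)
  have nonneg: "gap t \<ge> 0" for t using envelope_mono[OF B] by (simp add: gap_def)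
  obtain M where M: "\<And>t. t \<in> T \<Longrightarrow> \<bar>gap t\<bar> \<le> M" using continuous_bounded_on_T[OF cgap] by blast
  have cfg: "continuous_on T (\<lambda>t. f t * gap t)" by (intro continuous_intros f_continuous cgap)
  have fg: "f t * gap t \<ge> 0" if "t \<in> T" for t using nonneg f_positive[OF that] by simp
  have "integral T (\<lambda>t. f t * gap t) = integral\<^sup>L type_dist gap"
    by (rule integral_type_dist_HK[symmetric, OF borel_measurable_continuous_on_restrict[OF cgap] M])
  also have "\<dots> \<le> 0" using le continuous_integrable_type_dist[OF cB(1)] continuous_integrable_type_dist[OF cB(2)] by (simp add: gap_def[abs_def])
  moreover have "integral T (\<lambda>t. f t * gap t) \<ge> 0"
    by (rule Henstock_Kurzweil_Integration.integral_nonneg)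
      (use cfg fg in \<open>auto simp: T_def intro: integrable_continuous_real\<close>)
  ultimately have "((\<lambda>t. f t * gap t) has_integral 0) T"
    using integrable_integral[OF integrable_continuous_real[of tl th "\<lambda>t. f t * gap t"]] cfg by (simp add: T_def)
  then have zero: "f t * gap t = 0" if "t \<in> T" for t
    using has_integral_0_cbox_imp_0[of tl th "\<lambda>t. f t * gap t" t] cfg fg that tl_less_th
    by (auto simp: T_def)
  show ?thesis unfolding envelope_optimal_menu_def
  proof (intro conjI ballI B)
    fix t assume t: "t \<in> T"
    have "envelope B t \<in> (\<lambda>b. \<phi> b t) ` B"
      unfolding envelope_def using B finite_subset[OF B(1) finite_bundles] by (intro Max_in) auto
    then obtain b where b: "b \<in> B" "envelope B t = \<phi> b t" by auto
    have "envelope bundles t = \<phi> b t" using zero[OF t] f_positive[OF t] b by (simp add: gap_def)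
    then have "b \<in> argmax_\<phi> t" using b B \<phi>_le_envelope[of bundles _ t] by (auto simp: argmax_\<phi>_iff)
    with b show "argmax_\<phi> t \<inter> B \<noteq> {}" by blast
  qed
qed

end

section \<open>Monotone value differences and single crossing of virtual values\<close>

lemma derivative_nonneg_of_monotone_on:
  fixes g :: "real \<Rightarrow> real"
  assumes der: "(g has_vector_derivative D) (at t within S)"
    and mono: "monotone_on S (\<le>) (\<le>) g" and t: "t \<in> S" and nontriv: "at t within S \<noteq> bot"
  shows "0 \<le> D"
proof (rule tendsto_lowerbound[OF _ _ nontriv])
  show "((\<lambda>s. (g s - g t) / (s - t)) \<longlongrightarrow> D) (at t within S)"
    using der by (simp flip: has_real_derivative_iff_has_vector_derivative add: has_field_derivative_iff)
  have "0 \<le> (g s - g t) / (s - t)" if "s \<in> S" "s \<noteq> t" for s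
    using monotone_onD[OF mono, of s t] monotone_onD[OF mono, of t s] that t
    by (cases "s < t") (auto simp: divide_nonpos_neg divide_nonneg_pos)
  then show "\<forall>\<^sub>F s in at t within S. 0 \<le> (g s - g t) / (s - t)"
    by (auto simp: eventually_at_filter intro!: always_eventually)
qed

context monopoly
begin

lemma v_t_le_of_monotone_on:
  assumes b: "b \<in> bundles" and c: "c \<in> bundles" and t: "t \<in> T"
    and mono: "monotone_on T (\<le>) (\<le>) (\<lambda>t. v b t - v c t)"
  shows "v_t c t \<le> v_t b t"
proof -
  have "((\<lambda>t. v b t - v c t) has_vector_derivative v_t b t - v_t c t) (at t within T)"
    by (intro has_vector_derivative_diff v_has_derivative b c t)
  moreover have "at t within T \<noteq> bot"
    using t tl_less_th by (auto simp: T_def trivial_limit_within islimpt_Icc)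
  ultimately show ?thesis using derivative_nonneg_of_monotone_on[OF _ mono t] by fastforce
qed

text \<open>No distortion at the top: \<open>1 - F th = 0\<close> removes the rent term.\<close>

lemma \<phi>_th: "\<phi> b th = v b th"
  by (simp add: \<phi>_def F_th)

lemma \<phi>_diff: "\<phi> b t - \<phi> c t = (v b t - v c t) - (1 - F t) / f t * (v_t b t - v_t c t)"
  by (simp add: \<phi>_def algebra_simps)

text \<open>A decreasing value difference has a nonpositive derivative, so subtracting the rent term
  can only raise the virtual difference above the value difference. The latter is smallest at
  \<open>th\<close>, where the two agree.\<close>

lemma \<phi>_diff_ge_of_antimonotone:
  assumes "b \<in> bundles" "c \<in> bundles" and t: "t \<in> T"
    and anti: "monotone_on T (\<le>) (\<ge>) (\<lambda>t. v b t - v c t)"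
  shows "\<phi> b th - \<phi> c th \<le> \<phi> b t - \<phi> c t"
proof -
  have "monotone_on T (\<le>) (\<le>) (\<lambda>t. v c t - v b t)"
    using anti by (auto simp: monotone_on_def algebra_simps)
  then have "v_t b t \<le> v_t c t" using assms v_t_le_of_monotone_on by blast
  then have "(1 - F t) / f t * (v_t b t - v_t c t) \<le> 0"
    using F_le_1[of t] f_positive[OF t] by (intro mult_nonneg_nonpos) auto
  moreover have "v b th - v c th \<le> v b t - v c t"
    using monotone_onD[OF anti t th_in_T] t by (auto simp: T_def)
  ultimately show ?thesis by (simp add: \<phi>_diff[of b t c] \<phi>_th)
qed

text \<open>If the value difference were decreasing, the virtual difference at \<open>th\<close>
  would be no larger than at \<open>s\<close>. Single crossing, however, keeps its sign at
  \<open>th\<close> at least as high as at \<open>t\<close>. One strict inequality at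
  \<open>s\<close> or \<open>t\<close> makes the two incompatible.\<close>

lemma monotone_of_crossing:
  assumes bc: "b \<in> bundles" "c \<in> bundles"
    and crossing: "single_crossing_on T (\<lambda>t. \<phi> b t - \<phi> c t)"
    and mono: "monotonic_on T (\<lambda>t. v b t - v c t)"
    and st: "s \<in> T" "t \<in> T" "s \<le> t"
    and signs: "\<phi> b s \<le> \<phi> c s" "\<phi> c t \<le> \<phi> b t" "\<phi> b s \<noteq> \<phi> c s \<or> \<phi> c t \<noteq> \<phi> b t"
  shows "monotone_on T (\<le>) (\<le>) (\<lambda>t. v b t - v c t)"
proof (rule ccontr)
  assume "\<not> ?thesis"
  with mono have anti: "monotone_on T (\<le>) (\<ge>) (\<lambda>t. v b t - v c t)" by (simp add: monotonic_on_def)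
  have ge: "\<phi> b th - \<phi> c th \<le> \<phi> b r - \<phi> c r" if "r \<in> T" for r
    using \<phi>_diff_ge_of_antimonotone[OF bc that anti] .
  \<comment> \<open>The strict inequality makes the sign at \<open>t\<close> exceed the sign at
    \<open>s\<close>, which excludes the decreasing alternative of single crossing.\<close>
  have "\<not> monotone_on T (\<le>) (\<ge>) (\<lambda>t. sgn (\<phi> b t - \<phi> c t))"
    using monotone_onD[of T "(\<le>)" "(\<ge>)" "\<lambda>t. sgn (\<phi> b t - \<phi> c t)" s t] st signs
    by (auto simp: sgn_if split: if_splits)
  then have up: "monotone_on T (\<le>) (\<le>) (\<lambda>t. sgn (\<phi> b t - \<phi> c t))"
    using crossing by (simp add: single_crossing_on_def monotonic_on_def)
  have "sgn (\<phi> b t - \<phi> c t) \<le> sgn (\<phi> b th - \<phi> c th)"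
    using monotone_onD[OF up st(2) th_in_T] st by (auto simp: T_def)
  with ge[OF st(1)] signs show False by (auto simp: sgn_if split: if_splits)
qed

lemma argmax_\<phi>_nonempty: "argmax_\<phi> t \<noteq> {}"
proof -
  have "Max ((\<lambda>b. \<phi> b t) ` bundles) \<in> (\<lambda>b. \<phi> b t) ` bundles"
    using finite_bundles empty_in_bundles by (intro Max_in) auto
  then obtain b where b: "b \<in> bundles" "Max ((\<lambda>b. \<phi> b t) ` bundles) = \<phi> b t" by auto
  then have "\<phi> c t \<le> \<phi> b t" if "c \<in> bundles" for c
    using \<phi>_le_envelope[OF subset_refl that, of t] b(2) by (simp add: envelope_def)
  with b have "b \<in> argmax_\<phi> t" by (simp add: argmax_\<phi>_iff)
  then show ?thesis by blast
qed

text \<open>Ensures that the lowest type gets a bundle of value zero, so that rents can start at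
  zero and individual rationality follows.\<close>

lemma argmax_\<phi>_tl: "b \<in> argmax_\<phi> tl \<Longrightarrow> b = {}"
proof (rule ccontr)
  assume b: "b \<in> argmax_\<phi> tl" "b \<noteq> {}"
  then have "\<phi> b tl \<le> Max ((\<lambda>b. \<phi> b tl) ` (bundles - {{}}))"
    by (intro Max_ge) (auto simp: finite_bundles argmax_\<phi>_iff)
  moreover have "\<phi> {} tl \<le> \<phi> b tl" using b empty_in_bundles by (auto simp: argmax_\<phi>_iff)
  ultimately show False using \<phi>_lowest by simp
qed

section \<open>Optimal menus and implementation of monotone selections\<close>

lemma v_t_has_integral:
  assumes "b \<in> bundles" "x \<in> T" "y \<in> T" "x \<le> y"
  shows "(v_t b has_integral (v b y - v b x)) {x..y}"
  by (rule fundamental_theorem_of_calculus, fact,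
      rule has_vector_derivative_within_subset[OF v_has_derivative])
    (use assms in \<open>auto simp: T_def\<close>)

text \<open>An optimal mechanism with menu \<open>B\<close> earns at least the attained value and,
  by \<open>revenue_le_envelope\<close>, at most the expected envelope of \<open>B\<close>. This is
  the premise of \<open>envelope_optimal_if_integral_eq\<close>.\<close>

lemma optimal_menu_bounded_by_envelope:
  assumes "optimal_menu B" and attained: "mechanism a' p'" "IC a' p'" "IR a' p'"
    and rev: "revenue p' = integral\<^sup>L type_dist (envelope bundles)"
  shows "envelope_optimal_menu B"
proof -
  obtain a p where B: "B \<subseteq> bundles" and opt: "optimal_mechanism a p" and a: "\<And>t. t \<in> T \<Longrightarrow> a t \<in> return_pmf ` B"
    using assms(1) by (auto simp: optimal_menu_def)
  have "integral\<^sup>L type_dist (envelope bundles) \<le> revenue p"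
    using opt attained by (simp add: optimal_mechanism_def flip: rev)
  also have "\<dots> \<le> integral\<^sup>L type_dist (envelope B)"
  proof (rule revenue_le_envelope[of a])
    show "set_pmf (a t) \<subseteq> B" if "t \<in> T" for t using a[OF that] by auto
  qed (use opt B in \<open>auto simp: optimal_mechanism_def\<close>)
  finally show ?thesis
    using a[OF tl_in_T] by (intro envelope_optimal_if_integral_eq B) auto
qed

lemma weighted_sum_return_pmf:
  "b \<in> bundles \<Longrightarrow> (\<Sum>c\<in>bundles. pmf (return_pmf b) c * g c :: real) = g b"
  by (subst sum.remove[OF finite_bundles]) (auto simp: indicator_def intro!: sum.neutral)

lemma value_of_return_pmf: "value_of (return_pmf b) t = v b t"
  by (simp add: value_of_def)

text \<open>Since \<open>v_t (b t) r\<close> rises with \<open>t\<close>, integrating between two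
  types compares the value of a deviation with the difference in rents. This gives all incentive
  constraints, not only local ones.\<close>

lemma monotone_selection_optimal:
  assumes sel_meas: "\<And>c. {t \<in> T. b t = c} \<in> sets (restrict_space borel T)"
    and sel: "\<And>t. t \<in> T \<Longrightarrow> b t \<in> argmax_\<phi> t"
    and v_t_sel: "\<And>r s t. r \<in> T \<Longrightarrow> s \<in> T \<Longrightarrow> t \<in> T \<Longrightarrow> s \<le> t \<Longrightarrow> v_t (b s) r \<le> v_t (b t) r"
  obtains p where "mechanism (\<lambda>t. return_pmf (b t)) p" "IC (\<lambda>t. return_pmf (b t)) p"
    "IR (\<lambda>t. return_pmf (b t)) p" "revenue p = integral\<^sup>L type_dist (envelope bundles)"
proof -
  define a where "a t = return_pmf (b t)" for t
  have b: "b t \<in> bundles" if "t \<in> T" for t using sel[OF that] by (simp add: argmax_\<phi>_iff)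
  have weights: "(\<lambda>t. pmf (a t) c) \<in> borel_measurable (restrict_space borel T)" for c
  proof -
    have "indicator {t \<in> T. b t = c} \<in> borel_measurable (restrict_space borel T)"
      by (rule borel_measurable_indicator[OF sel_meas])
    then show "(\<lambda>t. pmf (a t) c) \<in> borel_measurable (restrict_space borel T)"
      by (rule measurable_cong[THEN iffD1, rotated]) (auto simp: a_def indicator_def space_restrict_space)
  qed
  have stoch: "a t \<in> stochastic_bundles" if "t \<in> T" for t
    using b[OF that] by (simp add: a_def stochastic_bundles_def)
  \<comment> \<open>Zero payments are a placeholder: the rent identities concern the allocation, and
    they are needed to show that the actual payments are measurable.\<close>
  have mech0: "mechanism a (\<lambda>_. 0)" using weights stoch by (simp add: mechanism_def)
  define q where "q t = (\<Sum>c\<in>bundles. pmf (a t) c * v_t c t)" for t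
  define U where "U t = integral {tl..t} q" for t
  \<comment> \<open>These payments leave type \<open>t\<close> exactly the rent \<open>U t\<close>
    of the envelope formula, starting from zero at \<open>tl\<close>.\<close>
  define p where "p t = value_of (a t) t - U t" for t
  note smr = surplus_minus_rent[OF mech0, folded q_def U_def]
  have q: "q t = v_t (b t) t" if "t \<in> T" for t
    using weighted_sum_return_pmf[OF b[OF that]] by (simp add: q_def a_def)
  have q_int: "(q has_integral (U y - U x)) {x..y}" if "x \<in> T" "y \<in> T" "x \<le> y" for x y
  proof -
    have "q integrable_on {tl..y}" "q integrable_on {x..y}"
      by (rule integrable_on_subinterval[OF smr(4)], use that in \<open>auto simp: T_def\<close>)+
    moreover from this have "U y - U x = integral {x..y} q"
      using Henstock_Kurzweil_Integration.integral_combine[of tl x y q] that by (simp add: U_def T_def)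
    ultimately show ?thesis using integrable_integral by fastforce
  qed
  have mech: "mechanism a p"
    using weights stoch borel_measurable_integrable[OF smr(1)]
    by (simp add: mechanism_def p_def[abs_def] measurable_cong_sets[OF sets_type_dist refl])
  have IC: "IC a p" unfolding IC_def
  proof (intro ballI)
    fix t t' assume t: "t \<in> T" "t' \<in> T"
    \<comment> \<open>Type \<open>t\<close> imitating \<open>t'\<close> obtains
      \<open>U t' + v (b t') t - v (b t') t'\<close>, so this inequality is the incentive
      constraint.\<close>
    have "v (b t') t - v (b t') t' \<le> U t - U t'"
    proof (cases "t' \<le> t")
      case True
      show ?thesis
        by (rule has_integral_le[OF v_t_has_integral[OF b[OF t(2)] t(2,1) True] q_int[OF t(2,1) True]])
          (use t q v_t_sel[OF _ t(2)] in \<open>auto simp: T_def\<close>)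
    next
      case False
      then have le: "t \<le> t'" by simp
      have "U t' - U t \<le> v (b t') t' - v (b t') t"
        by (rule has_integral_le[OF q_int[OF t le] v_t_has_integral[OF b[OF t(2)] t le]])
          (use t q v_t_sel[OF _ _ t(2)] in \<open>auto simp: T_def\<close>)
      then show ?thesis by simp
    qed
    then show "value_of (a t') t - p t' \<le> value_of (a t) t - p t"
      by (simp add: p_def a_def value_of_return_pmf)
  qed
  have b_tl: "b tl = {}" using argmax_\<phi>_tl[OF sel[OF tl_in_T]] .
  have "p tl = 0" using v_empty[OF tl_in_T] by (simp add: p_def U_def a_def value_of_return_pmf b_tl)
  \<comment> \<open>Every type can imitate \<open>tl\<close>, who gets the empty bundle for
    free.\<close>
  then have "IR a p" unfolding IR_def
    using IC v_empty tl_in_T by (force simp: IC_def a_def value_of_return_pmf b_tl)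
  moreover have "revenue p = integral\<^sup>L type_dist (envelope bundles)"
    unfolding revenue_def p_def smr(2)
    by (intro Bochner_Integration.integral_cong refl)
      (use envelope_eq_argmax[OF sel] weighted_sum_return_pmf[OF b] in \<open>simp add: space_type_dist a_def\<close>)
  ultimately show ?thesis using that mech IC unfolding a_def by blast
qed

end

section \<open>Selection from the argmax by the largest gain in value\<close>

locale single_crossing_menu = monopoly +
  fixes \<B>' :: "nat set set"
  assumes subset_bundles: "\<B>' \<subseteq> bundles"
    and crossing: "\<And>b c. b \<in> \<B>' \<Longrightarrow> c \<in> \<B>' \<Longrightarrow> single_crossing_on T (\<lambda>t. \<phi> b t - \<phi> c t)"
    and monotonic: "\<And>b c. b \<in> \<B>' \<Longrightarrow> c \<in> \<B>' \<Longrightarrow> monotonic_on T (\<lambda>t. v b t - v c t)"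
    and argmax_subset: "\<And>t. t \<in> T \<Longrightarrow> argmax_\<phi> t \<subseteq> \<B>'"
begin

text \<open>A numerical index for the direction of value differences: these are monotonic within
  \<open>\<B>'\<close>, so \<open>gain c \<le> gain b\<close> means that \<open>v b - v c\<close> is
  increasing.\<close>

definition gain :: "nat set \<Rightarrow> real" where
  "gain b = v b th - v b tl"

text \<open>A monotonic function with equal values at both endpoints is constant.\<close>

lemma equal_gain_imp_constant_difference:
  assumes "b \<in> \<B>'" "c \<in> \<B>'" "gain b = gain c" "t \<in> T"
  shows "v b t - v c t = v b th - v c th"
proof -
  have "tl \<le> t" "t \<le> th" using assms(4) by (auto simp: T_def)
  then show ?thesis
    using monotonic[OF assms(1,2)] assms(3,4) tl_in_T th_in_T
      monotone_onD[of T "(\<le>)" _ "\<lambda>t. v b t - v c t" tl t] monotone_onD[of T "(\<le>)" _ "\<lambda>t. v b t - v c t" t th]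
    unfolding monotonic_on_def gain_def by (smt (verit))
qed

lemma equal_gain_imp_monotone:
  assumes "b \<in> \<B>'" "c \<in> \<B>'" "gain b = gain c"
  shows "monotone_on T (\<le>) (\<le>) (\<lambda>t. v b t - v c t)"
  by (rule monotone_onI) (simp add: equal_gain_imp_constant_difference[OF assms])

text \<open>Equal gains make the value difference constant, so marginal values agree and the virtual
  difference is the same constant. Optimality of \<open>b\<close> at \<open>s\<close> and of
  \<open>c\<close> at \<open>t\<close> forces it to be zero, against \<open>\<phi>_distinct\<close>
  unless the bundles coincide. Hence the gain identifies a selected bundle.\<close>

lemma argmax_equal_gain_imp_eq:
  assumes s: "s \<in> T" "b \<in> argmax_\<phi> s" and t: "t \<in> T" "c \<in> argmax_\<phi> t" and gain: "gain b = gain c"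
  shows "b = c"
proof -
  have bc: "b \<in> \<B>'" "c \<in> \<B>'" using assms argmax_subset by blast+
  then have bc': "b \<in> bundles" "c \<in> bundles" using subset_bundles by auto
  have diff: "\<phi> b r - \<phi> c r = v b th - v c th" if "r \<in> T" for r
  proof -
    have "v_t b r = v_t c r"
      using v_t_le_of_monotone_on[OF bc' that] v_t_le_of_monotone_on[OF bc'(2,1) that]
        equal_gain_imp_monotone bc gain by (simp add: order_antisym)
    then show ?thesis using equal_gain_imp_constant_difference[OF bc gain that] by (simp add: \<phi>_diff)
  qed
  have "\<phi> c s \<le> \<phi> b s" "\<phi> b t \<le> \<phi> c t" using s t bc' by (auto simp: argmax_\<phi>_iff)
  with diff[OF s(1)] diff[OF t(1)] have "v b th - v c th = 0" by linarith
  then have "\<phi> b r = \<phi> c r" if "r \<in> T" for r using diff[OF that] by simp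
  then show ?thesis using \<phi>_distinct[OF bc'] by blast
qed

text \<open>If one of the two comparisons is strict, \<open>monotone_of_crossing\<close> applies. If
  both are ties, each bundle is available at both types, and breaking ties by the largest gain makes
  the gains equal.\<close>

lemma argmax_monotone:
  assumes st: "s \<in> T" "t \<in> T" "s \<le> t"
    and b: "b \<in> argmax_\<phi> s \<inter> B" "\<And>c. c \<in> argmax_\<phi> s \<inter> B \<Longrightarrow> gain c \<le> gain b"
    and c: "c \<in> argmax_\<phi> t \<inter> B" "\<And>b. b \<in> argmax_\<phi> t \<inter> B \<Longrightarrow> gain b \<le> gain c"
  shows "monotone_on T (\<le>) (\<le>) (\<lambda>r. v c r - v b r)"
proof -
  have bc: "b \<in> \<B>'" "c \<in> \<B>'" using assms argmax_subset by blast+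
  then have bc': "b \<in> bundles" "c \<in> bundles" using subset_bundles by auto
  have le: "\<phi> c s \<le> \<phi> b s" "\<phi> b t \<le> \<phi> c t" using b(1) c(1) bc' by (auto simp: argmax_\<phi>_iff)
  show ?thesis
  proof (cases "\<phi> c s = \<phi> b s \<and> \<phi> b t = \<phi> c t")
    case True
    then have "c \<in> argmax_\<phi> s" "b \<in> argmax_\<phi> t" using b(1) c(1) by (auto simp: argmax_\<phi>_iff)
    then have "gain b = gain c" using b c by (intro order_antisym) auto
    then show ?thesis using equal_gain_imp_monotone bc by simp
  next
    case False
    then show ?thesis
      using le st by (intro monotone_of_crossing[OF bc'(2,1) crossing[OF bc(2,1)] monotonic[OF bc(2,1)], of s t]) auto
  qed
qed

text \<open>The selection takes the available maximizer of largest gain. It is a mere choice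
  function, so its measurability is recovered from the monotonicity of its gain in the type.\<close>

lemma envelope_optimal_imp_mechanism:
  assumes "envelope_optimal_menu B"
  obtains a p where "mechanism a p" "IC a p" "IR a p"
    "revenue p = integral\<^sup>L type_dist (envelope bundles)" "\<And>t. t \<in> T \<Longrightarrow> a t \<in> return_pmf ` B"
proof -
  have "\<exists>b. b \<in> argmax_\<phi> t \<inter> B \<and> (\<forall>c\<in>argmax_\<phi> t \<inter> B. gain c \<le> gain b)" if "t \<in> T" for t
  proof -
    have ne: "argmax_\<phi> t \<inter> B \<noteq> {}" "finite (argmax_\<phi> t \<inter> B)"
      using assms that finite_subset[OF _ finite_bundles]
      by (auto simp: envelope_optimal_menu_def argmax_\<phi>_iff subset_iff)
    then have "Max (gain ` (argmax_\<phi> t \<inter> B)) \<in> gain ` (argmax_\<phi> t \<inter> B)" by (intro Max_in) auto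
    then obtain b where "b \<in> argmax_\<phi> t \<inter> B" "Max (gain ` (argmax_\<phi> t \<inter> B)) = gain b" by auto
    moreover from this have "gain c \<le> gain b" if "c \<in> argmax_\<phi> t \<inter> B" for c
      using Max_ge[of "gain ` (argmax_\<phi> t \<inter> B)" "gain c"] ne that by simp
    ultimately show ?thesis by blast
  qed
  then obtain b where b: "\<And>t. t \<in> T \<Longrightarrow> b t \<in> argmax_\<phi> t \<inter> B"
    "\<And>t c. t \<in> T \<Longrightarrow> c \<in> argmax_\<phi> t \<inter> B \<Longrightarrow> gain c \<le> gain (b t)" by metis
  have mono: "monotone_on T (\<le>) (\<le>) (\<lambda>r. v (b t) r - v (b s) r)" if "s \<in> T" "t \<in> T" "s \<le> t" for s t
    by (rule argmax_monotone[OF that b(1,2)[OF that(1)] b(1,2)[OF that(2)]])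
  have "mono_on T (\<lambda>t. gain (b t))"
  proof (rule mono_onI)
    fix s t assume st: "s \<in> T" "t \<in> T" "s \<le> t"
    have "v (b t) tl - v (b s) tl \<le> v (b t) th - v (b s) th"
      using monotone_onD[OF mono[OF st] tl_in_T th_in_T] tl_less_th by simp
    then show "gain (b s) \<le> gain (b t)" by (simp add: gain_def)
  qed
  then have gain_meas: "(\<lambda>t. gain (b t)) \<in> borel_measurable (restrict_space borel T)"
    by (rule borel_measurable_mono_on_fnc)
  have meas: "{t \<in> T. b t = c} \<in> sets (restrict_space borel T)" for c
  proof (cases "\<exists>t\<in>T. b t = c")
    case True
    \<comment> \<open>By \<open>argmax_equal_gain_imp_eq\<close> the gain is injective on selected
      bundles, so the fibre over \<open>c\<close> is a level set of a monotone function.\<close>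
    then have "{t \<in> T. b t = c} = (\<lambda>t. gain (b t)) -` {gain c} \<inter> space (restrict_space borel T)"
      using argmax_equal_gain_imp_eq b(1) by (fastforce simp: space_restrict_space)
    then show ?thesis using measurable_sets[OF gain_meas, of "{gain c}"] by simp
  next
    case False
    then have "{t \<in> T. b t = c} = {}" by blast
    then show ?thesis by (metis sets.empty_sets)
  qed
  have in_bundles: "b t \<in> bundles" if "t \<in> T" for t using b(1)[OF that] by (auto simp: argmax_\<phi>_iff)
  obtain p where "mechanism (\<lambda>t. return_pmf (b t)) p" "IC (\<lambda>t. return_pmf (b t)) p"
    "IR (\<lambda>t. return_pmf (b t)) p" "revenue p = integral\<^sup>L type_dist (envelope bundles)"
  proof (rule monotone_selection_optimal[of b])
    show "v_t (b s) r \<le> v_t (b t) r" if "r \<in> T" "s \<in> T" "t \<in> T" "s \<le> t" for r s t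
      by (rule v_t_le_of_monotone_on[OF in_bundles[OF that(3)] in_bundles[OF that(2)] that(1) mono[OF that(2-4)]])
  qed (use meas b(1) in auto)
  then show ?thesis using that[of "\<lambda>t. return_pmf (b t)" p] b(1) by blast
qed

text \<open>The expected envelope of all bundles bounds every revenue, and a menu meeting each
  argmax attains it. Applied to the full menu, this shows that the bound is attained, so an optimal
  menu has to attain it too.\<close>

lemma optimal_menu_iff_envelope: "optimal_menu B \<longleftrightarrow> envelope_optimal_menu B"
proof
  assume B: "envelope_optimal_menu B"
  then obtain a p where ap: "mechanism a p" "IC a p" "IR a p"
    "revenue p = integral\<^sup>L type_dist (envelope bundles)" "\<And>t. t \<in> T \<Longrightarrow> a t \<in> return_pmf ` B"
    using envelope_optimal_imp_mechanism by metis
  have "revenue p' \<le> revenue p" if "mechanism a' p'" "IC a' p'" "IR a' p'" for a' p'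
    unfolding ap(4) by (rule revenue_le_envelope[OF that])
      (use that in \<open>auto simp: mechanism_def stochastic_bundles_def\<close>)
  with ap have "optimal_mechanism a p" by (auto simp: optimal_mechanism_def)
  with ap(5) B show "optimal_menu B" by (auto simp: optimal_menu_def envelope_optimal_menu_def)
next
  assume B: "optimal_menu B"
  have "envelope_optimal_menu bundles"
    using argmax_\<phi>_nonempty by (fastforce simp: envelope_optimal_menu_def argmax_\<phi>_iff)
  then obtain a p where "mechanism a p" "IC a p" "IR a p"
    "revenue p = integral\<^sup>L type_dist (envelope bundles)"
    using envelope_optimal_imp_mechanism by metis
  then show "envelope_optimal_menu B" by (rule optimal_menu_bounded_by_envelope[OF B])
qed

lemma minimal_optimal_menu_iff_envelope:
  "minimal_optimal_menu B \<longleftrightarrow> minimal_envelope_optimal_menu B"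
  by (simp add: minimal_optimal_menu_def minimal_envelope_optimal_menu_def optimal_menu_iff_envelope)

text \<open>Every argmax lies in \<open>\<B>'\<close>, so cutting a menu down to
  \<open>\<B>'\<close> preserves optimality; a minimal menu cannot shrink.\<close>

lemma minimal_envelope_optimal_menu_subset:
  assumes "minimal_envelope_optimal_menu B"
  shows "B \<subseteq> \<B>'"
proof -
  have B: "B \<subseteq> bundles" "\<And>t. t \<in> T \<Longrightarrow> argmax_\<phi> t \<inter> B \<noteq> {}"
    using assms by (auto simp: minimal_envelope_optimal_menu_def envelope_optimal_menu_def)
  have "argmax_\<phi> t \<inter> (B \<inter> \<B>') \<noteq> {}" if "t \<in> T" for t
    using B(2)[OF that] argmax_subset[OF that] by blast
  with B(1) have "envelope_optimal_menu (B \<inter> \<B>')"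
    unfolding envelope_optimal_menu_def by blast
  then have "\<not> B \<inter> \<B>' \<subset> B"
    using assms unfolding minimal_envelope_optimal_menu_def by metis
  then show ?thesis by (metis inf.absorb_iff1 inf_le1 psubsetI)
qed

end

theorem theorem6:
  fixes n :: nat
    and tl th :: real
    and f :: "real \<Rightarrow> real"
    and v :: "nat set \<Rightarrow> real \<Rightarrow> real"
    and \<B>' :: "nat set set"
  assumes "monopoly n tl th f v"
    and "\<B>' \<subseteq> monopoly_data.bundles n"
    and "\<And>b b'. b \<in> \<B>' \<Longrightarrow> b' \<in> \<B>' \<Longrightarrow>
           single_crossing_on (monopoly_data.T tl th)
             (\<lambda>t. monopoly_data.\<phi> tl th f v b t - monopoly_data.\<phi> tl th f v b' t)"
    and "\<And>b b'. b \<in> \<B>' \<Longrightarrow> b' \<in> \<B>' \<Longrightarrow>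
           monotonic_on (monopoly_data.T tl th) (\<lambda>t. v b t - v b' t)"
    and "\<And>t. t \<in> monopoly_data.T tl th \<Longrightarrow> monopoly_data.argmax_\<phi> n tl th f v t \<subseteq> \<B>'"
  shows "{B. monopoly_data.minimal_optimal_menu n tl th f v B} =
           {B. monopoly_data.minimal_envelope_optimal_menu n tl th f v B} \<and>
         (\<forall>B. monopoly_data.minimal_optimal_menu n tl th f v B \<longrightarrow> B \<subseteq> \<B>')"
proof -
  interpret monopoly n tl th f v by (fact assms(1))
  interpret single_crossing_menu n tl th f v \<B>'
    by unfold_locales (use assms(2-5) in blast)+
  show ?thesis
    using minimal_optimal_menu_iff_envelope minimal_envelope_optimal_menu_subset by blast
qed

end
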